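(* Consider the one-round offloading model described in the context, with parameters $\lambda>0$, $\mu>0$, $U_{\rm max}\in(0,\infty)$, integer $M\ge 1$ and $B_{\rm o}>0$, in which all SNRs $\gamma_{(k)}$ have the same distribution. Let $q_{\rm o}=\Pr(U_{(k)}\le U_{\rm max})=1-e^{-\mu U_{\rm max}}$ and $$\mu_{\rm max}=\frac{1}{\mathbb{E}[\tilde U_{(m)}\mid \tilde U_{(m)}\le U_{\rm max}]}=\frac{\mu(1-e^{-\mu U_{\rm max}})}{1-e^{-\mu U_{\rm max}}(1+\mu U_{\rm max})},$$ where the conditional expectation is the mean of an exponential random variable with parameter $\mu$ conditioned to be at most $U_{\rm max}$. Then the mean of the total upload time $D$ satisfies $\mathbb{E}[D]=\mathbb{E}[S]\,\mathbb{E}[\tilde T_{(m)}]$ with $\mathbb{E}[S]=\lambda q_{\rm o}e^{-\lambda q_{\rm o}/M}$, and $$\mathbb{E}[D]=\lambda q_{\rm o}e^{-\frac{\lambda q_{\rm o}}{M}}\,\frac{1}{B_{\rm o}\mu_{\rm max}}\,\mathbb{E}\left[\frac{1}{\log_2(1+\tilde\gamma_{(m)})}\right]$$ $$\le \lambda q_{\rm o}e^{-\frac{\lambda q_{\rm o}}{M}}\,\frac{\ln 2}{B_{\rm o}\mu_{\rm max}}\left(\frac12+\mathbb{E}\left[\frac{1}{\tilde\gamma_{(m)}}\right]\right)\le \lambda q_{\rm o}e^{-\frac{\lambda q_{\rm o}}{M}}\,\frac{\ln 2}{B_{\rm o}\mu}\left(\frac12+\mathbb{E}\left[\frac{1}{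\tilde\gamma_{(m)}}\right]\right).$$
   Context: One-round offloading model. The number $K$ of active devices is Poisson with mean $\lambda$. Active device $k$ has an input size $U_{(k)}$ that is exponentially distributed with density $\mu e^{-\mu u}$, $u\ge 0$ (so $\mathbb{E}[U_{(k)}]=1/\mu$), and a signal-to-noise ratio (SNR) $\gamma_{(k)}>0$ with $\mathbb{E}[1/\gamma_{(k)}]<\infty$. An active device is called contending if and only if $U_{(k)}\le U_{\rm max}$; $W$ is the number of contending devices. Each contending device picks one of $M$ random access channels uniformly at random, and it succeeds (is an offloading device) if and only if no other contending device picks the same channel; $S$ is the number of offloading devices. The random variables $K$, all input sizes, all SNRs, and all channel choices are mutually independent. For the $m$th offloading device, $m=1,\dots,S$, let $\tilde U_{(m)}$ and $\tilde\gamma_{(m)}$ be its input size and SNR (so $\tilde U_{(m)}$ has the distribution of $U_{(k)}$ conditioned on $U_{(k)}\le U_{\rm max}$, and $\tilde\gamma_{(m)}$ has the common distribution of the $\gamma_{(k)}$). Its upload time is $$\tilde T_{(m)}=\frac{\tilde U_{(m)}}{B_{\rm o}\log_2(1+\tilde\gamma_{(m)})},$$ where $B_{\rm o}>0$ is the bandwidth of the offloading channel. The total upload time is $D=\sum_{m=1}^{S}\tilde T_{(m)}$ (with $D=0$ if $S=0$). *)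

theory Defs
  imports "HOL-Probability.Probability"
begin

text \<open>
  Devices are numbered \<open>0, 1, 2, \<dots>\<close>; the active ones are those with number below \<open>K \<omega>\<close>.
  \<open>U k\<close>, \<open>\<gamma> k\<close> and \<open>C k\<close> are the input size, the SNR and the random access channel of device \<open>k\<close>;
  the channel of a device is only used if the device is contending.
\<close>

datatype rv_index = Num_Active | Input_Size nat | SNR nat | Channel nat

text \<open>
  All random variables as one family, so that the library notion of mutual independence applies.
  Embedding the natural-number valued ones into the reals does not change the \<open>\<sigma>\<close>-algebras they generate.
\<close>

fun rv_family ::
  "('a \<Rightarrow> nat) \<Rightarrow> (nat \<Rightarrow> 'a \<Rightarrow> real) \<Rightarrow> (nat \<Rightarrow> 'a \<Rightarrow> real) \<Rightarrow> (nat \<Rightarrow> 'a \<Rightarrow> nat) \<Rightarrow> rv_index \<Rightarrow> 'a \<Rightarrow> real"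
where
  "rv_family K U \<gamma> C Num_Active = (\<lambda>\<omega>. real (K \<omega>))"
| "rv_family K U \<gamma> C (Input_Size k) = U k"
| "rv_family K U \<gamma> C (SNR k) = \<gamma> k"
| "rv_family K U \<gamma> C (Channel k) = (\<lambda>\<omega>. real (C k \<omega>))"

locale offloading_model = prob_space P
  for P :: "'a measure"
    and K :: "'a \<Rightarrow> nat"
    and U :: "nat \<Rightarrow> 'a \<Rightarrow> real"
    and \<gamma> :: "nat \<Rightarrow> 'a \<Rightarrow> real"
    and C :: "nat \<Rightarrow> 'a \<Rightarrow> nat"
    and lam mu Umax :: real
    and M :: nat
    and Bo :: real +
  assumes lam_pos: "lam > 0"
    and mu_pos: "mu > 0"
    and Umax_pos: "Umax > 0"
    and M_ge_1: "M \<ge> 1"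
    and Bo_pos: "Bo > 0"
    and K_measurable: "K \<in> measurable P (count_space UNIV)"
    and K_distr: "distr P (count_space UNIV) K = measure_pmf (poisson_pmf lam)"
    and U_distr: "\<And>k. distributed P lborel (U k) (exponential_density mu)"
    and SNR_measurable: "\<And>k. \<gamma> k \<in> borel_measurable P"
    and SNR_pos: "\<And>k. AE \<omega> in P. \<gamma> k \<omega> > 0"
    and SNR_ident: "\<And>j k. distr P borel (\<gamma> j) = distr P borel (\<gamma> k)"
    and SNR_inverse_integrable: "\<And>k. integrable P (\<lambda>\<omega>. 1 / \<gamma> k \<omega>)"
    and C_measurable: "\<And>k. C k \<in> measurable P (count_space UNIV)"
    and C_distr: "\<And>k. distr P (count_space UNIV) (C k) = measure_pmf (pmf_of_set {..<M})"
    and indep: "indep_vars (\<lambda>_. borel) (rv_family K U \<gamma> C) UNIV"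

definition contending :: "('a \<Rightarrow> nat) \<Rightarrow> (nat \<Rightarrow> 'a \<Rightarrow> real) \<Rightarrow> real \<Rightarrow> 'a \<Rightarrow> nat set" where
  "contending K U Umax \<omega> = {k. k < K \<omega> \<and> U k \<omega> \<le> Umax}"

definition offloading ::
  "('a \<Rightarrow> nat) \<Rightarrow> (nat \<Rightarrow> 'a \<Rightarrow> real) \<Rightarrow> (nat \<Rightarrow> 'a \<Rightarrow> nat) \<Rightarrow> real \<Rightarrow> 'a \<Rightarrow> nat set" where
  "offloading K U C Umax \<omega> =
     {k \<in> contending K U Umax \<omega>. \<forall>j \<in> contending K U Umax \<omega>. j \<noteq> k \<longrightarrow> C j \<omega> \<noteq> C k \<omega>}"

definition num_offloading ::
  "('a \<Rightarrow> nat) \<Rightarrow> (nat \<Rightarrow> 'a \<Rightarrow> real) \<Rightarrow> (nat \<Rightarrow> 'a \<Rightarrow> nat) \<Rightarrow> real \<Rightarrow> 'a \<Rightarrow> nat" where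
  "num_offloading K U C Umax \<omega> = card (offloading K U C Umax \<omega>)"

text \<open>
  The offloading devices are numbered \<open>m = 0, \<dots>, S - 1\<close> in increasing order of device number;
  the value below is meaningful only for \<open>m < S\<close>.
\<close>

definition offloading_device ::
  "('a \<Rightarrow> nat) \<Rightarrow> (nat \<Rightarrow> 'a \<Rightarrow> real) \<Rightarrow> (nat \<Rightarrow> 'a \<Rightarrow> nat) \<Rightarrow> real \<Rightarrow> nat \<Rightarrow> 'a \<Rightarrow> nat" where
  "offloading_device K U C Umax m \<omega> = sorted_list_of_set (offloading K U C Umax \<omega>) ! m"

definition offl_size ::
  "('a \<Rightarrow> nat) \<Rightarrow> (nat \<Rightarrow> 'a \<Rightarrow> real) \<Rightarrow> (nat \<Rightarrow> 'a \<Rightarrow> nat) \<Rightarrow> real \<Rightarrow> nat \<Rightarrow> 'a \<Rightarrow> real" where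
  "offl_size K U C Umax m \<omega> = U (offloading_device K U C Umax m \<omega>) \<omega>"

definition offl_snr ::
  "('a \<Rightarrow> nat) \<Rightarrow> (nat \<Rightarrow> 'a \<Rightarrow> real) \<Rightarrow> (nat \<Rightarrow> 'a \<Rightarrow> real) \<Rightarrow> (nat \<Rightarrow> 'a \<Rightarrow> nat) \<Rightarrow> real \<Rightarrow>
   nat \<Rightarrow> 'a \<Rightarrow> real" where
  "offl_snr K U \<gamma> C Umax m \<omega> = \<gamma> (offloading_device K U C Umax m \<omega>) \<omega>"

definition upload_time ::
  "('a \<Rightarrow> nat) \<Rightarrow> (nat \<Rightarrow> 'a \<Rightarrow> real) \<Rightarrow> (nat \<Rightarrow> 'a \<Rightarrow> real) \<Rightarrow> (nat \<Rightarrow> 'a \<Rightarrow> nat) \<Rightarrow> real \<Rightarrow> real \<Rightarrow>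
   nat \<Rightarrow> 'a \<Rightarrow> real" where
  "upload_time K U \<gamma> C Umax Bo m \<omega> =
     offl_size K U C Umax m \<omega> / (Bo * log 2 (1 + offl_snr K U \<gamma> C Umax m \<omega>))"

definition total_upload_time ::
  "('a \<Rightarrow> nat) \<Rightarrow> (nat \<Rightarrow> 'a \<Rightarrow> real) \<Rightarrow> (nat \<Rightarrow> 'a \<Rightarrow> real) \<Rightarrow> (nat \<Rightarrow> 'a \<Rightarrow> nat) \<Rightarrow> real \<Rightarrow> real \<Rightarrow>
   'a \<Rightarrow> real" where
  "total_upload_time K U \<gamma> C Umax Bo \<omega> =
     (\<Sum>m<num_offloading K U C Umax \<omega>. upload_time K U \<gamma> C Umax Bo m \<omega>)"

definition cond_expectation :: "'a measure \<Rightarrow> ('a \<Rightarrow> real) \<Rightarrow> 'a set \<Rightarrow> real" where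
  "cond_expectation P X A = integral\<^sup>L (uniform_measure P A) X"

definition trunc_exp_rate :: "real \<Rightarrow> real \<Rightarrow> real" where
  "trunc_exp_rate mu Umax =
     1 / cond_expectation (density lborel (exponential_density mu)) (\<lambda>u. u) {..Umax}"

end

theory Submission
  imports Defs
begin

text \<open>
  An event \<open>Q\<close> about the set of offloading devices that forces device \<open>k\<close> to offload is the
  intersection of \<open>U k \<le> Umax\<close> with an event independent of \<open>U k\<close> and \<open>\<gamma> k\<close>. Hence, on \<open>Q\<close>, the pair
  \<open>(U k, \<gamma> k)\<close> has the law (truncated exponential) \<open>\<otimes>\<close> (SNR law), the same for all \<open>k\<close>. Summing over
  \<open>k\<close> the events \<open>the m-th offloading device is k\<close> gives the conditional law of \<open>(U', \<gamma>')\<close>; summing the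
  events \<open>k offloads\<close> gives Wald's identity \<open>E[D] = E[S] E[T']\<close>. The mean of \<open>S\<close> comes from splitting on
  \<open>K = n\<close> and on the channel of \<open>k\<close>: each of the other \<open>n - 1\<close> devices independently avoids colliding
  with \<open>k\<close> with probability \<open>1 - q\<^sub>o / M\<close>. The bound on the logarithm is \<open>2 x / (2 + x) \<le> ln (1 + x)\<close>.
\<close>

section \<open>Measurability of the offloading set and two elementary facts\<close>

text \<open>There are only countably many finite sets of naturals, so single fibres suffice. The
  measure \<open>N\<close> is general because the lemma is applied to \<open>P\<close> and also to a
  product space of coordinates.\<close>

lemma measurable_offloading:
  assumes [measurable]: "K \<in> measurable N (count_space UNIV)"
    "\<And>k. U k \<in> borel_measurable N" "\<And>k. C k \<in> measurable N (count_space UNIV)"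
  shows "offloading K U C u \<in> measurable N (count_space (Collect finite))"
proof -
  define c where "c k \<omega> \<longleftrightarrow> k < K \<omega> \<and> U k \<omega> \<le> u" for k \<omega>
  define e where "e j k \<omega> \<longleftrightarrow> C j \<omega> = C k \<omega>" for j k \<omega>
  have c: "Measurable.pred N (c k)" for k
    unfolding c_def[abs_def] by measurable
  \<comment> \<open>Two random naturals are compared by a countable case split on the value of
    \<open>C j\<close>.\<close>
  have e: "Measurable.pred N (e j k)" for j k
    unfolding e_def[abs_def]
    by (rule measurable_compose_countable[where f = "\<lambda>n \<omega>. n = C k \<omega>"])
      (auto intro: measurable_compose[where N = "count_space UNIV"])
  \<comment> \<open>Set equality is spelled out elementwise, so that a fibre is described by
    countable quantifiers over measurable predicates.\<close>
  have iff: "offloading K U C u \<omega> = F \<longleftrightarrow>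
      (\<forall>k. (c k \<omega> \<and> (\<forall>j. c j \<omega> \<longrightarrow> j \<noteq> k \<longrightarrow> \<not> e j k \<omega>)) = (k \<in> F))" for F \<omega>
    unfolding c_def e_def offloading_def contending_def set_eq_iff by simp
  have "offloading K U C u -` {F} \<inter> space N = {\<omega> \<in> space N.
      \<forall>k. (c k \<omega> \<and> (\<forall>j. c j \<omega> \<longrightarrow> j \<noteq> k \<longrightarrow> \<not> e j k \<omega>)) = (k \<in> F)}" for F
    by (intro set_eqI) (simp only: vimage_eq Int_iff mem_Collect_eq singleton_iff iff conj_commute)
  also have "\<dots> F \<in> sets N" for F
    unfolding pred_def[symmetric]
    by (intro pred_intros_countable pred_intros_logic c e) simp_all
  finally show ?thesis
    by (subst measurable_count_space_eq_countable)
      (auto simp: countable_Collect_finite offloading_def contending_def intro!: finite_subset[of _ "{..<K _}"])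
qed

text \<open>The constants come from the lower bound \<open>2 * x / (2 + x)\<close> for
  \<open>ln (1 + x)\<close>: its reciprocal is exactly \<open>1 / 2 + 1 / x\<close>, and
  \<open>ln 2\<close> is the change of base.\<close>

lemma one_div_log_le:
  fixes x :: real
  assumes "x > 0"
  shows "1 / log 2 (1 + x) \<le> ln 2 * (1 / 2 + 1 / x)"
proof -
  have "(\<lambda>x. ln (1 + x) - 2 * x / (2 + x)) 0 \<le> (\<lambda>x::real. ln (1 + x) - 2 * x / (2 + x)) x"
  proof (rule DERIV_nonneg_imp_nondecreasing[where f = "\<lambda>x::real. ln (1 + x) - 2 * x / (2 + x)"])
    fix y :: real assume y: "0 \<le> y"
    have "((\<lambda>x::real. ln (1 + x) - 2 * x / (2 + x)) has_real_derivative
        1 / (1 + y) - 4 / (2 + y)\<^sup>2) (at y)"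
      using y by (auto intro!: derivative_eq_intros simp: power2_eq_square field_simps)
    \<comment> \<open>After clearing denominators the difference of the two sides is
      \<open>y\<^sup>2\<close>.\<close>
    moreover have "4 / (2 + y)\<^sup>2 \<le> 1 / (1 + y)"
      using y by (simp add: divide_simps power2_eq_square algebra_simps)
    ultimately show "\<exists>D. ((\<lambda>x::real. ln (1 + x) - 2 * x / (2 + x)) has_real_derivative D) (at y) \<and> 0 \<le> D"
      by (intro exI conjI) auto
  qed (use assms in auto)
  then have le: "2 * x / (2 + x) \<le> ln (1 + x)" by simp
  have "1 / ln (1 + x) \<le> 1 / (2 * x / (2 + x))"
    using assms by (intro divide_left_mono le mult_pos_pos ln_gt_zero) auto
  also have "\<dots> = 1 / 2 + 1 / x" using assms by (simp add: field_simps)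
  finally have "ln 2 * (1 / ln (1 + x)) \<le> ln 2 * (1 / 2 + 1 / x)"
    by (intro mult_left_mono) auto
  then show ?thesis by (simp add: log_def)
qed

text \<open>Expectations below are first computed in \<open>ennreal\<close> up to the factor
  \<open>prob_cont\<close>; this removes the factor. An infinite \<open>x\<close> is impossible
  because the product is finite.\<close>

lemma ennreal_cancel_eq:
  assumes "0 < c" "0 \<le> d" "ennreal c * x = ennreal d"
  shows "x = ennreal (d / c)"
proof (cases x)
  case (real r)
  then have "c * r = d" using assms by (simp flip: ennreal_mult)
  then show ?thesis using real assms by (simp add: field_simps)
next
  case top
  then show ?thesis using assms by (simp add: ennreal_mult_top)
qed

section \<open>Measurability inside the model\<close>

context offloading_model
begin

abbreviation Off where "Off \<equiv> offloading K U C Umax"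
abbreviation input_law where "input_law \<equiv> density lborel (\<lambda>x. ennreal (exponential_density mu x))"
text \<open>Device 0 represents the common law of all SNRs.\<close>

abbreviation snr_law where "snr_law \<equiv> distr P borel (\<gamma> 0)"

declare K_measurable [measurable] SNR_measurable [measurable] C_measurable [measurable]

lemma U_measurable [measurable]: "U k \<in> borel_measurable P"
  using distributed_measurable[OF U_distr] by simp

lemma Off_measurable [measurable]: "Off \<in> measurable P (count_space (Collect finite))"
  by (rule measurable_offloading) auto

text \<open>Since \<open>Off\<close> takes countably many values, it can be frozen at a fixed finite
  set when measurability is checked.\<close>

lemma measurable_of_Off:
  assumes "\<And>F. finite F \<Longrightarrow> (\<lambda>\<omega>. f F \<omega>) \<in> measurable P N"
  shows "(\<lambda>\<omega>. f (Off \<omega>) \<omega>) \<in> measurable P N"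
  by (rule measurable_compose_countable'[OF _ Off_measurable])
    (auto simp: assms countable_Collect_finite)

lemma finite_Off [simp]: "finite (Off \<omega>)"
  by (rule finite_subset[of _ "{..<K \<omega>}"]) (auto simp: offloading_def contending_def)

lemma Off_event [measurable]: "{\<omega> \<in> space P. Q (Off \<omega>)} \<in> sets P"
proof -
  have "Measurable.pred P (\<lambda>\<omega>. Q (Off \<omega>))"
    by (rule measurable_of_Off[where f = "\<lambda>F _. Q F"]) simp
  then show ?thesis by (simp add: pred_def)
qed

lemma mem_Off_measurable [measurable]: "Measurable.pred P (\<lambda>\<omega>. k \<in> Off \<omega>)"
  using Off_event[of "\<lambda>F. k \<in> F"] by (simp add: pred_def)

section \<open>Laws of a single device and their product form on offloading events\<close>

lemma nn_integral_U:
  assumes [measurable]: "a \<in> borel_measurable borel"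
  shows "(\<integral>\<^sup>+\<omega>. a (U k \<omega>) \<partial>P) = (\<integral>\<^sup>+u. a u \<partial>input_law)"
  using distributed_nn_integral[OF U_distr, of a k]
  by (subst nn_integral_density) auto

lemma nn_integral_SNR:
  assumes [measurable]: "b \<in> borel_measurable borel"
  shows "(\<integral>\<^sup>+\<omega>. b (\<gamma> k \<omega>) \<partial>P) = (\<integral>\<^sup>+s. b s \<partial>snr_law)"
  by (subst SNR_ident[of 0 k]) (simp add: nn_integral_distr)

text \<open>Whether device \<open>k\<close> offloads depends on its own input size only through \<open>U k \<le> Umax\<close>:
  replacing \<open>U k\<close> by \<open>Umax\<close> yields an event independent of \<open>U k\<close> and \<open>\<gamma> k\<close>.\<close>

lemma Off_contending:
  assumes Q: "\<And>F. Q F \<Longrightarrow> k \<in> F"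
  shows "Q (Off \<omega>) \<longleftrightarrow> U k \<omega> \<le> Umax \<and> Q (offloading K (U(k := \<lambda>_. Umax)) C Umax \<omega>)"
proof (cases "U k \<omega> \<le> Umax")
  case True
  then have "contending K (U(k := \<lambda>_. Umax)) Umax \<omega> = contending K U Umax \<omega>"
    by (auto simp: contending_def)
  then show ?thesis using True by (simp add: offloading_def)
next
  case False
  then have "k \<notin> Off \<omega>" by (auto simp: offloading_def contending_def)
  then show ?thesis using False Q by auto
qed

text \<open>The family splits into three independent blocks: the size of \<open>k\<close>, the SNR
  of \<open>k\<close>, and everything else. By \<open>Off_contending\<close>, the event
  \<open>Q (Off \<omega>)\<close> is a condition on the first block together with a condition on the
  third.\<close>

lemma nn_integral_Off_product:
  fixes a b :: "real \<Rightarrow> ennreal"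
  assumes [measurable]: "a \<in> borel_measurable borel" "b \<in> borel_measurable borel"
    and Q: "\<And>F. Q F \<Longrightarrow> k \<in> F"
  shows "(\<integral>\<^sup>+\<omega>. a (U k \<omega>) * b (\<gamma> k \<omega>) * indicator {\<omega>. Q (Off \<omega>)} \<omega> \<partial>P) =
    (\<integral>\<^sup>+u. a u * indicator {..Umax} u \<partial>input_law) * (\<integral>\<^sup>+s. b s \<partial>snr_law) *
    (\<integral>\<^sup>+\<omega>. indicator {\<omega>. Q (offloading K (U(k := \<lambda>_. Umax)) C Umax \<omega>)} \<omega> \<partial>P)"
proof -
  define G where "G i = (if i = 0 then {Input_Size k} else if i = 1 then {SNR k}
      else UNIV - {Input_Size k, SNR k})" for i :: nat
  \<comment> \<open>The offloading set as a function of a real-valued configuration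
    \<open>y\<close>: \<open>nat\<close> of the floor undoes the embedding of naturals, and the size
    of device \<open>k\<close> is fixed at \<open>Umax\<close>.\<close>
  define W where "W = (\<lambda>y. offloading (\<lambda>y. nat \<lfloor>y Num_Active\<rfloor>)
    (\<lambda>j y. if j = k then Umax else y (Input_Size j)) (\<lambda>j y. nat \<lfloor>y (Channel j)\<rfloor>) Umax (y :: rv_index \<Rightarrow> real))"
  define Y where "Y i y = (if i = 0 then a (y (Input_Size k)) * indicator {..Umax} (y (Input_Size k))
      else if i = 1 then b (y (SNR k)) else indicator {y. Q (W y)} y)" for i :: nat and y
  define X where "X i \<omega> = Y i (\<lambda>j\<in>G i. rv_family K U \<gamma> C j \<omega>)" for i \<omega>
  have comp: "(\<lambda>y. y j) \<in> borel_measurable (PiM (G i) (\<lambda>_. borel))" if "j \<in> G i" for i j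
    using that by (rule measurable_component_singleton)
  have W: "W \<in> measurable (PiM (G 2) (\<lambda>_. borel)) (count_space (Collect finite))"
    unfolding W_def
  proof (rule measurable_offloading)
    show "(\<lambda>y. if j = k then Umax else y (Input_Size j)) \<in> borel_measurable (PiM (G 2) (\<lambda>_. borel))" for j
      by (cases "j = k") (auto intro!: comp simp: G_def)
  qed (auto intro!: measurable_compose[OF comp] simp: G_def)
  have "Measurable.pred (PiM (G 2) (\<lambda>_. borel)) (\<lambda>y. Q (W y))"
    using measurable_compose[OF W, of Q "count_space UNIV"] by simp
  then have Y2: "Y 2 \<in> borel_measurable (PiM (G 2) (\<lambda>_. borel))"
    by (simp add: Y_def[abs_def])
  have [measurable]: "(\<lambda>y. y (Input_Size k)) \<in> borel_measurable (PiM (G 0) (\<lambda>_. borel))"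
     "(\<lambda>y. y (SNR k)) \<in> borel_measurable (PiM (G 1) (\<lambda>_. borel))"
    by (auto intro!: comp simp: G_def)
  have "indep_vars (\<lambda>_. borel) X {0, 1, 2}"
    unfolding X_def
  proof (rule indep_vars_compose2[OF indep_vars_restrict[OF indep]])
    show "disjoint_family_on G {0, 1, 2}" by (auto simp: disjoint_family_on_def G_def)
    fix i :: nat assume "i \<in> {0, 1, 2}"
    moreover have "Y 0 \<in> borel_measurable (PiM (G 0) (\<lambda>_. borel))"
      by (simp add: Y_def[abs_def])
    moreover have "Y 1 \<in> borel_measurable (PiM (G 1) (\<lambda>_. borel))"
      by (simp add: Y_def[abs_def] del: One_nat_def)
    ultimately show "Y i \<in> borel_measurable (PiM (G i) (\<lambda>_. borel))"
      using Y2 by auto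
  qed auto
  then have "(\<integral>\<^sup>+\<omega>. (\<Prod>i\<in>{0, 1, 2}. X i \<omega>) \<partial>P) = (\<Prod>i\<in>{0, 1, 2}. \<integral>\<^sup>+\<omega>. X i \<omega> \<partial>P)"
    by (intro indep_vars_nn_integral) auto
  moreover have "X 0 = (\<lambda>\<omega>. a (U k \<omega>) * indicator {..Umax} (U k \<omega>))" "X 1 = (\<lambda>\<omega>. b (\<gamma> k \<omega>))"
    by (auto simp: X_def Y_def G_def fun_eq_iff)
  \<comment> \<open>\<open>W\<close> reads neither the size nor the SNR of \<open>k\<close>, so
    restricting the family to the third block leaves its value unchanged. The channel of
    \<open>k\<close> belongs to that block.\<close>
  moreover have "W (\<lambda>j\<in>G 2. rv_family K U \<gamma> C j \<omega>) = offloading K (U(k := \<lambda>_. Umax)) C Umax \<omega>" for \<omega>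
    unfolding W_def offloading_def contending_def by (auto simp: G_def)
  then have "X 2 = indicator {\<omega>. Q (offloading K (U(k := \<lambda>_. Umax)) C Umax \<omega>)}"
    by (auto simp: X_def Y_def fun_eq_iff indicator_def)
  moreover have "a (U k \<omega>) * b (\<gamma> k \<omega>) * indicator {\<omega>. Q (Off \<omega>)} \<omega> = (\<Prod>i\<in>{0, 1, 2}. X i \<omega>)" for \<omega>
    using calculation(2-4) Off_contending[where Q = Q and k = k and \<omega> = \<omega>, OF Q]
    by (auto simp: indicator_def mult_ac)
  ultimately show ?thesis
    by (simp add: nn_integral_SNR mult_ac nn_integral_U[of "\<lambda>u. a u * indicator {..Umax} u" k])
qed

text \<open>Taking \<open>a = b = 1\<close> in the product formula expresses the probability of
  \<open>Q (Off \<omega>)\<close> through the modified event, which can then be eliminated. The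
  normalising mass stays on the left to avoid division in \<open>ennreal\<close>.\<close>

lemma nn_integral_Off:
  fixes a b :: "real \<Rightarrow> ennreal"
  assumes [measurable]: "a \<in> borel_measurable borel" "b \<in> borel_measurable borel"
    and Q: "\<And>F. Q F \<Longrightarrow> k \<in> F"
  shows "emeasure input_law {..Umax} *
      (\<integral>\<^sup>+\<omega>. a (U k \<omega>) * b (\<gamma> k \<omega>) * indicator {\<omega>. Q (Off \<omega>)} \<omega> \<partial>P) =
    (\<integral>\<^sup>+u. a u * indicator {..Umax} u \<partial>input_law) * (\<integral>\<^sup>+s. b s \<partial>snr_law) *
    (\<integral>\<^sup>+\<omega>. indicator {\<omega>. Q (Off \<omega>)} \<omega> \<partial>P)"
proof -
  interpret G: prob_space snr_law by (rule prob_space_distr) simp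
  show ?thesis
    using nn_integral_Off_product[of a b Q k, OF _ _ Q]
      nn_integral_Off_product[of "\<lambda>_. 1" "\<lambda>_. 1" Q k, OF _ _ Q] G.emeasure_space_1
    by (simp add: mult_ac)
qed

section \<open>Measurability of the numbered quantities and totals\<close>

lemma offl_size_measurable [measurable]: "offl_size K U C Umax m \<in> borel_measurable P"
  unfolding offl_size_def[abs_def] offloading_device_def
  by (rule measurable_of_Off[where f = "\<lambda>F \<omega>. U (sorted_list_of_set F ! m) \<omega>"]) simp

lemma offl_snr_measurable [measurable]: "offl_snr K U \<gamma> C Umax m \<in> borel_measurable P"
  unfolding offl_snr_def[abs_def] offloading_device_def
  by (rule measurable_of_Off[where f = "\<lambda>F \<omega>. \<gamma> (sorted_list_of_set F ! m) \<omega>"]) simp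

lemma num_offloading_measurable [measurable]: "num_offloading K U C Umax \<in> measurable P (count_space UNIV)"
  unfolding num_offloading_def[abs_def]
  by (rule measurable_of_Off[where f = "\<lambda>F \<omega>. card F"]) simp

lemma upload_time_measurable [measurable]: "upload_time K U \<gamma> C Umax Bo m \<in> borel_measurable P"
  unfolding upload_time_def[abs_def] by measurable

lemma total_upload_time_measurable [measurable]: "total_upload_time K U \<gamma> C Umax Bo \<in> borel_measurable P"
  unfolding total_upload_time_def[abs_def] num_offloading_def
  by (rule measurable_of_Off[where f = "\<lambda>F \<omega>. \<Sum>m<card F. upload_time K U \<gamma> C Umax Bo m \<omega>"]) simp

lemma indicator_Off_measurable [measurable]: "indicator {\<omega>. Q (Off \<omega>)} \<in> borel_measurable P"
proof -
  have "(indicator {\<omega>. Q (Off \<omega>)} :: _ \<Rightarrow> 'b) = (\<lambda>\<omega>. if Q (Off \<omega>) then 1 else 0)"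
    by (auto simp: fun_eq_iff)
  also have "\<dots> \<in> borel_measurable P"
    by (rule measurable_of_Off[where f = "\<lambda>F \<omega>. if Q F then 1 else 0"]) simp
  finally show ?thesis .
qed

section \<open>Law of the m-th offloading device and Wald's identity\<close>

text \<open>The event is partitioned by the identity \<open>k\<close> of the m-th offloading device.
  The factors for \<open>a\<close> and \<open>b\<close> are the same for every \<open>k\<close>, so
  they leave the sum, and the remaining indicators recombine.\<close>

lemma nn_integral_offloading_device:
  fixes a b :: "real \<Rightarrow> ennreal"
  assumes [measurable]: "a \<in> borel_measurable borel" "b \<in> borel_measurable borel"
  shows "emeasure input_law {..Umax} *
      (\<integral>\<^sup>+\<omega>. a (offl_size K U C Umax m \<omega>) * b (offl_snr K U \<gamma> C Umax m \<omega>) *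
        indicator {\<omega>. m < num_offloading K U C Umax \<omega>} \<omega> \<partial>P) =
    (\<integral>\<^sup>+u. a u * indicator {..Umax} u \<partial>input_law) * (\<integral>\<^sup>+s. b s \<partial>snr_law) *
    (\<integral>\<^sup>+\<omega>. indicator {\<omega>. m < num_offloading K U C Umax \<omega>} \<omega> \<partial>P)"
proof -
  \<comment> \<open>The bound \<open>m < card F\<close> makes the list access legitimate, so that
    \<open>Q k F\<close> forces \<open>k \<in> F\<close>.\<close>
  define Q where "Q k F \<longleftrightarrow> finite F \<and> m < card F \<and> sorted_list_of_set F ! m = k" for k :: nat and F
  have Q: "k \<in> F" if "Q k F" for k F
    using that nth_mem[of m "sorted_list_of_set F"] by (auto simp: Q_def)
  have split: "f (offloading_device K U C Umax m \<omega>) \<omega> * indicator {\<omega>. m < num_offloading K U C Umax \<omega>} \<omega> =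
      (\<Sum>k. f k \<omega> * indicator {\<omega>. Q k (Off \<omega>)} \<omega>)" for f :: "nat \<Rightarrow> 'a \<Rightarrow> ennreal" and \<omega>
    by (subst suminf_finite[of "{offloading_device K U C Umax m \<omega>}"])
      (auto simp: Q_def num_offloading_def offloading_device_def indicator_def)
  have "emeasure input_law {..Umax} *
      (\<integral>\<^sup>+\<omega>. (\<Sum>k. a (U k \<omega>) * b (\<gamma> k \<omega>) * indicator {\<omega>. Q k (Off \<omega>)} \<omega>) \<partial>P) =
      (\<Sum>k. emeasure input_law {..Umax} *
        (\<integral>\<^sup>+\<omega>. a (U k \<omega>) * b (\<gamma> k \<omega>) * indicator {\<omega>. Q k (Off \<omega>)} \<omega> \<partial>P))"
    by (subst nn_integral_suminf) auto
  also have "\<dots> = (\<integral>\<^sup>+u. a u * indicator {..Umax} u \<partial>input_law) * (\<integral>\<^sup>+s. b s \<partial>snr_law) *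
      (\<integral>\<^sup>+\<omega>. (\<Sum>k. 1 * indicator {\<omega>. Q k (Off \<omega>)} \<omega>) \<partial>P)"
    by (subst nn_integral_Off) (auto simp: Q nn_integral_suminf)
  finally show ?thesis
    unfolding split[of "\<lambda>k \<omega>. a (U k \<omega>) * b (\<gamma> k \<omega>)", symmetric] split[of "\<lambda>_ _. 1", symmetric]
    by (simp add: offl_size_def offl_snr_def)
qed

text \<open>Wald's identity before normalisation: the event for device \<open>k\<close> is
  \<open>k \<in> Off \<omega>\<close>, and the indicators of these events add up to the number of
  offloading devices.\<close>

lemma nn_integral_sum_Off:
  fixes a b :: "real \<Rightarrow> ennreal"
  assumes [measurable]: "a \<in> borel_measurable borel" "b \<in> borel_measurable borel"
  shows "emeasure input_law {..Umax} * (\<integral>\<^sup>+\<omega>. (\<Sum>k\<in>Off \<omega>. a (U k \<omega>) * b (\<gamma> k \<omega>)) \<partial>P) =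
    (\<integral>\<^sup>+u. a u * indicator {..Umax} u \<partial>input_law) * (\<integral>\<^sup>+s. b s \<partial>snr_law) *
    (\<integral>\<^sup>+\<omega>. of_nat (num_offloading K U C Umax \<omega>) \<partial>P)"
proof -
  have split: "(\<Sum>k\<in>Off \<omega>. f k \<omega>) = (\<Sum>k. f k \<omega> * indicator {\<omega>. k \<in> Off \<omega>} \<omega>)"
    for f :: "nat \<Rightarrow> 'a \<Rightarrow> ennreal" and \<omega>
    by (subst suminf_finite[of "Off \<omega>"]) auto
  have "emeasure input_law {..Umax} *
      (\<integral>\<^sup>+\<omega>. (\<Sum>k. a (U k \<omega>) * b (\<gamma> k \<omega>) * indicator {\<omega>. k \<in> Off \<omega>} \<omega>) \<partial>P) =
      (\<Sum>k. emeasure input_law {..Umax} *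
        (\<integral>\<^sup>+\<omega>. a (U k \<omega>) * b (\<gamma> k \<omega>) * indicator {\<omega>. k \<in> Off \<omega>} \<omega> \<partial>P))"
    by (subst nn_integral_suminf) auto
  also have "\<dots> = (\<integral>\<^sup>+u. a u * indicator {..Umax} u \<partial>input_law) * (\<integral>\<^sup>+s. b s \<partial>snr_law) *
      (\<integral>\<^sup>+\<omega>. (\<Sum>k. 1 * indicator {\<omega>. k \<in> Off \<omega>} \<omega>) \<partial>P)"
    by (subst nn_integral_Off) (auto simp: nn_integral_suminf)
  finally show ?thesis
    unfolding split[of "\<lambda>k \<omega>. a (U k \<omega>) * b (\<gamma> k \<omega>)", symmetric] split[of "\<lambda>_ _. 1", symmetric]
    by (simp add: num_offloading_def)
qed

section \<open>Mean number of offloading devices\<close>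

text \<open>The closed form of \<open>qo\<close>, identified with the probability of contending in
  \<open>prob_contending\<close>.\<close>

definition "prob_cont = 1 - exp (- mu * Umax)"

lemma prob_cont_bounds: "0 < prob_cont" "prob_cont < 1"
  using mu_pos Umax_pos by (auto simp: prob_cont_def)

lemma prob_contending: "prob {\<omega> \<in> space P. U k \<omega> \<le> Umax} = prob_cont"
  using exponential_distributedD_le[OF U_distr, of Umax k] mu_pos Umax_pos
  by (simp add: prob_cont_def mult.commute)

lemma prob_K: "prob {\<omega> \<in> space P. K \<omega> = n} = lam ^ n / fact n * exp (- lam)"
proof -
  have "prob {\<omega> \<in> space P. K \<omega> = n} = measure (distr P (count_space UNIV) K) {n}"
    by (subst measure_distr) (auto intro!: arg_cong[where f = prob])
  then show ?thesis using lam_pos by (simp add: K_distr measure_pmf_single)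
qed

lemma prob_C: "c < M \<Longrightarrow> prob {\<omega> \<in> space P. C k \<omega> = c} = 1 / real M"
proof -
  assume c: "c < M"
  have "prob {\<omega> \<in> space P. C k \<omega> = c} = measure (distr P (count_space UNIV) (C k)) {c}"
    by (subst measure_distr) (auto intro!: arg_cong[where f = prob])
  then show ?thesis using c by (subst (asm) C_distr) (auto simp: measure_pmf_single pmf_of_set lessThan_empty_iff)
qed

lemma AE_C_less: "AE \<omega> in P. C k \<omega> < M"
proof -
  have "AE c in distr P (count_space UNIV) (C k). c < M"
    using M_ge_1 by (subst C_distr) (auto simp: AE_measure_pmf_iff lessThan_empty_iff)
  then show ?thesis by (simp add: AE_distr_iff)
qed

lemma prob_contending_channel:
  assumes "c < M"
  shows "prob {\<omega> \<in> space P. U k \<omega> \<le> Umax \<and> C k \<omega> = c} = prob_cont / real M"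
proof -
  let ?A = "\<lambda>i. if i = Input_Size k then {..Umax} else {real c}"
  have "prob (\<Inter>i\<in>{Input_Size k, Channel k}. rv_family K U \<gamma> C i -` ?A i \<inter> space P) =
      (\<Prod>i\<in>{Input_Size k, Channel k}. prob (rv_family K U \<gamma> C i -` ?A i \<inter> space P))"
    by (rule indep_varsD[OF indep]) auto
  also have "\<dots> = prob {\<omega> \<in> space P. U k \<omega> \<le> Umax} * prob {\<omega> \<in> space P. C k \<omega> = c}"
    by (auto intro!: arg_cong2[where f = "(*)"] arg_cong[where f = prob])
  also have "(\<Inter>i\<in>{Input_Size k, Channel k}. rv_family K U \<gamma> C i -` ?A i \<inter> space P) =
      {\<omega> \<in> space P. U k \<omega> \<le> Umax \<and> C k \<omega> = c}" by auto
  finally show ?thesis using assms by (simp add: prob_contending prob_C)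
qed

text \<open>Fixing the channel \<open>c\<close> of device \<open>k\<close> is what gives
  independence: the other \<open>n - 1\<close> devices must each fail to contend on this
  deterministic channel, which has probability \<open>1 - prob_cont / real M\<close> for
  each.\<close>

lemma prob_Off_channel:
  assumes "k < n" "c < M"
  shows "prob {\<omega> \<in> space P. K \<omega> = n \<and> k \<in> Off \<omega> \<and> C k \<omega> = c} =
    lam ^ n / fact n * exp (- lam) * (prob_cont / real M) * (1 - prob_cont / real M) ^ (n - 1)"
proof -
  \<comment> \<open>The active devices are numbered below \<open>n\<close>, so index
    \<open>n\<close> is free for the block of \<open>K\<close>.\<close>
  define G where "G i = (if i = n then {Num_Active} else {Input_Size i, Channel i})" for i
  define E where "E i = (if i = n then {y \<in> space (PiM (G i) (\<lambda>_. borel)). y Num_Active = real n}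
    else if i = k then {y \<in> space (PiM (G i) (\<lambda>_. borel)). y (Input_Size i) \<le> Umax \<and> y (Channel i) = real c}
    else {y \<in> space (PiM (G i) (\<lambda>_. borel)). \<not> (y (Input_Size i) \<le> Umax \<and> y (Channel i) = real c)})" for i
  define V where "V i = (\<lambda>\<omega>. \<lambda>j\<in>G i. rv_family K U \<gamma> C j \<omega>) -` E i \<inter> space P" for i
  have comp: "(\<lambda>y. y j) \<in> borel_measurable (PiM (G i) (\<lambda>_. borel))" if "j \<in> G i" for i j
    using that by (rule measurable_component_singleton)
  have "E i \<in> sets (PiM (G i) (\<lambda>_. borel))" for i
  proof (cases "i = n")
    case True
    have [measurable]: "(\<lambda>y. y Num_Active) \<in> borel_measurable (PiM (G n) (\<lambda>_. borel))"
      by (auto intro!: comp simp: G_def)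
    show ?thesis using True by (simp add: E_def)
  next
    case False
    have [measurable]: "(\<lambda>y. y (Input_Size i)) \<in> borel_measurable (PiM (G i) (\<lambda>_. borel))"
      "(\<lambda>y. y (Channel i)) \<in> borel_measurable (PiM (G i) (\<lambda>_. borel))"
      using False by (auto intro!: comp simp: G_def)
    have "{y \<in> space (PiM (G i) (\<lambda>_. borel)). y (Input_Size i) \<le> Umax \<and> y (Channel i) = real c}
        \<in> sets (PiM (G i) (\<lambda>_. borel))"
      "{y \<in> space (PiM (G i) (\<lambda>_. borel)). \<not> (y (Input_Size i) \<le> Umax \<and> y (Channel i) = real c)}
        \<in> sets (PiM (G i) (\<lambda>_. borel))"
      by measurable
    then show ?thesis using False by (simp only: E_def if_False split: if_split) simp
  qed
  moreover have "disjoint_family_on G {..n}"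
    by (auto simp: disjoint_family_on_def G_def)
  ultimately have indep': "prob (\<Inter>i\<in>{..n}. V i) = (\<Prod>i\<in>{..n}. prob (V i))"
    unfolding V_def by (intro indep_varsD[OF indep_vars_restrict[OF indep]]) auto
  have space: "(\<lambda>j\<in>G i. rv_family K U \<gamma> C j \<omega>) \<in> space (PiM (G i) (\<lambda>_. borel))" for i \<omega>
    by (simp add: space_PiM)
  have Vn: "V n = {\<omega> \<in> space P. K \<omega> = n}"
    using space[of _ n] by (auto simp: V_def E_def G_def)
  have Vk: "V k = {\<omega> \<in> space P. U k \<omega> \<le> Umax \<and> C k \<omega> = c}"
    using space[of _ k] assms by (auto simp: V_def E_def G_def)
  have Vj: "V j = {\<omega> \<in> space P. \<not> (U j \<omega> \<le> Umax \<and> C j \<omega> = c)}" if "j < n" "j \<noteq> k" for j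
    using space[of _ j] that by (auto simp: V_def E_def G_def)
  \<comment> \<open>Given \<open>K = n\<close>, device \<open>k\<close> offloads on \<open>c\<close>
    exactly when it contends on \<open>c\<close> and no other device below \<open>n\<close>
    does.\<close>
  have "{\<omega> \<in> space P. K \<omega> = n \<and> k \<in> Off \<omega> \<and> C k \<omega> = c} =
      V n \<inter> V k \<inter> (\<Inter>j\<in>{..<n} - {k}. V j)"
    unfolding Vn Vk using assms by (auto simp: Vj offloading_def contending_def)
  also have "\<dots> = (\<Inter>i\<in>{..n}. V i)"
  proof -
    have "{..n} = insert n (insert k ({..<n} - {k}))" using assms by auto
    then show ?thesis by auto
  qed
  finally have "prob {\<omega> \<in> space P. K \<omega> = n \<and> k \<in> Off \<omega> \<and> C k \<omega> = c} = (\<Prod>i\<in>{..n}. prob (V i))"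
    using indep' by simp
  also have "{..n} = insert n (insert k ({..<n} - {k}))" using assms by auto
  also have "(\<Prod>i\<in>insert n (insert k ({..<n} - {k})). prob (V i)) =
      prob (V n) * prob (V k) * (\<Prod>i\<in>{..<n} - {k}. prob (V i))"
    using assms by (subst prod.insert, simp, simp, subst prod.insert) (auto simp: mult_ac)
  also have "(\<Prod>i\<in>{..<n} - {k}. prob (V i)) = (\<Prod>i\<in>{..<n} - {k}. 1 - prob_cont / real M)"
  proof (rule prod.cong)
    fix j assume "j \<in> {..<n} - {k}"
    then have "prob (V j) = prob {\<omega> \<in> space P. \<not> (U j \<omega> \<le> Umax \<and> C j \<omega> = c)}"
      by (simp add: Vj)
    also have "\<dots> = 1 - prob {\<omega> \<in> space P. U j \<omega> \<le> Umax \<and> C j \<omega> = c}"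
      by (rule prob_neg) measurable
    finally show "prob (V j) = 1 - prob_cont / real M"
      using assms by (simp add: prob_contending_channel)
  qed simp
  also have "\<dots> = (1 - prob_cont / real M) ^ (n - 1)"
    using assms by simp
  finally show ?thesis
    using assms by (simp add: Vn Vk prob_K prob_contending_channel)
qed

text \<open>The \<open>M\<close> channels contribute equally, which cancels one factor
  \<open>1 / M\<close>. Values of \<open>C k\<close> outside the channel range form a null
  event.\<close>

lemma prob_Off:
  assumes "k < n"
  shows "prob {\<omega> \<in> space P. K \<omega> = n \<and> k \<in> Off \<omega>} =
    lam ^ n / fact n * exp (- lam) * prob_cont * (1 - prob_cont / real M) ^ (n - 1)"
proof -
  have sets: "{\<omega> \<in> space P. K \<omega> = n \<and> k \<in> Off \<omega> \<and> C k \<omega> = c} \<in> sets P" for c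
    by measurable
  have "prob {\<omega> \<in> space P. K \<omega> = n \<and> k \<in> Off \<omega>} =
      prob (\<Union>c<M. {\<omega> \<in> space P. K \<omega> = n \<and> k \<in> Off \<omega> \<and> C k \<omega> = c})"
    using AE_C_less[of k] sets
    by (intro finite_measure_eq_AE) (auto elim!: eventually_mono)
  also have "\<dots> = (\<Sum>c<M. prob {\<omega> \<in> space P. K \<omega> = n \<and> k \<in> Off \<omega> \<and> C k \<omega> = c})"
    using sets by (intro finite_measure_finite_Union) (auto simp: disjoint_family_on_def)
  also have "\<dots> = lam ^ n / fact n * exp (- lam) * prob_cont * (1 - prob_cont / real M) ^ (n - 1)"
    using assms M_ge_1 by (simp add: prob_Off_channel)
  finally show ?thesis .
qed

text \<open>For \<open>K = n\<close> the \<open>n\<close> devices contribute equal probabilities,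
  whence the factor \<open>real n\<close> in \<open>?f\<close>. It cancels against the factorial and
  leaves an exponential series.\<close>

lemma nn_integral_num_offloading:
  "(\<integral>\<^sup>+\<omega>. of_nat (num_offloading K U C Umax \<omega>) \<partial>P) =
    ennreal (lam * prob_cont * exp (- lam * prob_cont / real M))"
proof -
  let ?r = "1 - prob_cont / real M"
  let ?f = "\<lambda>n. real n * (lam ^ n / fact n * exp (- lam) * prob_cont * ?r ^ (n - 1))"
  have r: "0 \<le> ?r" using prob_cont_bounds M_ge_1 by (simp add: divide_le_eq)
  have "of_nat (num_offloading K U C Umax \<omega>) =
      (\<Sum>n. \<Sum>k<n. indicator {\<omega> \<in> space P. K \<omega> = n \<and> k \<in> Off \<omega>} \<omega> :: ennreal)" if "\<omega> \<in> space P" for \<omega>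
  proof -
    have "Off \<omega> = {k \<in> {..<K \<omega>}. k \<in> Off \<omega>}" by (auto simp: offloading_def contending_def)
    then have "num_offloading K U C Umax \<omega> = card {k \<in> {..<K \<omega>}. k \<in> Off \<omega>}"
      unfolding num_offloading_def by (rule arg_cong)
    moreover have "of_nat (card {k \<in> {..<K \<omega>}. k \<in> Off \<omega>}) =
        (\<Sum>k<K \<omega>. if k \<in> Off \<omega> then 1 else 0 :: ennreal)"
      using sum.inter_filter[of "{..<K \<omega>}" "\<lambda>_. 1 :: ennreal" "\<lambda>k. k \<in> Off \<omega>"] by simp
    \<comment> \<open>Only the term with \<open>n = K \<omega>\<close> survives.\<close>
    moreover have "(\<Sum>n. \<Sum>k<n. indicator {\<omega> \<in> space P. K \<omega> = n \<and> k \<in> Off \<omega>} \<omega> :: ennreal) =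
        (\<Sum>k<K \<omega>. if k \<in> Off \<omega> then 1 else 0)"
    proof -
      have "(\<Sum>n. \<Sum>k<n. indicator {\<omega> \<in> space P. K \<omega> = n \<and> k \<in> Off \<omega>} \<omega> :: ennreal) =
          (\<Sum>n\<in>{K \<omega>}. \<Sum>k<n. indicator {\<omega> \<in> space P. K \<omega> = n \<and> k \<in> Off \<omega>} \<omega>)"
        by (rule suminf_finite) auto
      also have "\<dots> = (\<Sum>k<K \<omega>. indicator {\<omega>' \<in> space P. K \<omega>' = K \<omega> \<and> k \<in> Off \<omega>'} \<omega>)"
        by simp
      also have "\<dots> = (\<Sum>k<K \<omega>. if k \<in> Off \<omega> then 1 else 0)"
        by (intro sum.cong refl) (simp add: indicator_def that)
      finally show ?thesis .
    qed
    ultimately show ?thesis by (simp only:)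
  qed
  then have "(\<integral>\<^sup>+\<omega>. of_nat (num_offloading K U C Umax \<omega>) \<partial>P) =
      (\<integral>\<^sup>+\<omega>. (\<Sum>n. \<Sum>k<n. indicator {\<omega> \<in> space P. K \<omega> = n \<and> k \<in> Off \<omega>} \<omega>) \<partial>P)"
    by (intro nn_integral_cong) auto
  also have "\<dots> = (\<Sum>n. \<Sum>k<n. emeasure P {\<omega> \<in> space P. K \<omega> = n \<and> k \<in> Off \<omega>})"
    by (subst nn_integral_suminf) (auto simp: nn_integral_sum)
  also have "\<dots> = (\<Sum>n. ennreal (?f n))"
    using r lam_pos prob_cont_bounds
    by (auto simp: emeasure_eq_measure prob_Off ennreal_of_nat_eq_real_of_nat simp flip: ennreal_mult
        intro!: suminf_cong)
  also have "\<dots> = ennreal (lam * prob_cont * exp (- lam * prob_cont / real M))"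
  proof (rule suminf_ennreal_eq)
    \<comment> \<open>The series produces \<open>exp (lam * ?r)\<close>; multiplied by the Poisson
      factor \<open>exp (- lam)\<close>, this leaves the exponent
      \<open>- lam * prob_cont / real M\<close>.\<close>
    have "(\<lambda>n. (lam * ?r) ^ n /\<^sub>R fact n) sums exp (lam * ?r)"
      by (rule exp_converges)
    then have "(\<lambda>n. lam * prob_cont * exp (- lam) * ((lam * ?r) ^ n /\<^sub>R fact n)) sums
        (lam * prob_cont * exp (- lam) * exp (lam * ?r))"
      by (rule sums_mult)
    moreover have "lam * q * e * ((lam * r) ^ n /\<^sub>R fact n) =
        real (Suc n) * (lam ^ Suc n / fact (Suc n) * e * q * r ^ (Suc n - 1))" for n and q e r :: real
      by (simp add: field_simps power_mult_distrib del: of_nat_Suc)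
    moreover have "lam * prob_cont * exp (- lam) * exp (lam * ?r) =
        lam * prob_cont * exp (- lam * prob_cont / real M)"
      by (simp add: algebra_simps flip: exp_add)
    ultimately have "(\<lambda>n. ?f (Suc n)) sums (lam * prob_cont * exp (- lam * prob_cont / real M))"
      by simp
    \<comment> \<open>The term at \<open>n = 0\<close> carries the factor \<open>real 0\<close>, so
      the index shift changes nothing and the truncated \<open>n - 1\<close> does no harm
      there.\<close>
    then show "?f sums (lam * prob_cont * exp (- lam * prob_cont / real M))"
      by (subst (asm) sums_Suc_iff) simp
  qed (use r lam_pos prob_cont_bounds in auto)
  finally show ?thesis .
qed

section \<open>Positivity of the conditioning event\<close>

text \<open>An explicit event of positive probability is exhibited: exactly \<open>m + 1\<close>
  devices are active, all contend, and device \<open>j\<close> picks channel \<open>j\<close>. There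
  are enough channels because \<open>m < M\<close>, and then all \<open>m + 1\<close> devices
  offload.\<close>

lemma prob_num_offloading_pos:
  assumes "m < M"
  shows "0 < prob {\<omega> \<in> space P. m < num_offloading K U C Umax \<omega>}"
proof -
  define J where "J = insert Num_Active (Input_Size ` {..m} \<union> Channel ` {..m})"
  define A where "A i = (case i of Num_Active \<Rightarrow> {real (Suc m)} | Input_Size j \<Rightarrow> {..Umax}
    | SNR j \<Rightarrow> UNIV | Channel j \<Rightarrow> {real j})" for i
  let ?X = "rv_family K U \<gamma> C"
  have sing: "(\<lambda>\<omega>. real (f \<omega>)) -` {real n} \<inter> space P = {\<omega> \<in> space P. f \<omega> = n}" for f :: "'a \<Rightarrow> nat" and n
    by auto
  have atMost: "U j -` {..Umax} \<inter> space P = {\<omega> \<in> space P. U j \<omega> \<le> Umax}" for j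
    by auto
  have "prob (\<Inter>i\<in>J. ?X i -` A i \<inter> space P) = (\<Prod>i\<in>J. prob (?X i -` A i \<inter> space P))"
    by (rule indep_varsD[OF indep]) (auto simp: J_def A_def)
  also have "\<dots> > 0"
  proof (rule prod_pos)
    fix i assume "i \<in> J"
    then show "0 < prob (?X i -` A i \<inter> space P)"
      using assms prob_cont_bounds lam_pos unfolding J_def A_def
      by (auto simp: sing atMost prob_K prob_C prob_contending simp del: of_nat_Suc)
  qed
  finally have "0 < prob (\<Inter>i\<in>J. ?X i -` A i \<inter> space P)" .
  also have "\<dots> \<le> prob {\<omega> \<in> space P. m < num_offloading K U C Umax \<omega>}"
  proof (rule finite_measure_mono)
    show "(\<Inter>i\<in>J. ?X i -` A i \<inter> space P) \<subseteq> {\<omega> \<in> space P. m < num_offloading K U C Umax \<omega>}"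
    proof
      fix \<omega> assume \<omega>: "\<omega> \<in> (\<Inter>i\<in>J. ?X i -` A i \<inter> space P)"
      then have X: "?X i \<omega> \<in> A i" if "i \<in> J" for i using INT_D[OF \<omega> that] by auto
      have "K \<omega> = Suc m"
        using X[of Num_Active] by (simp add: J_def A_def del: of_nat_Suc)
      moreover have "U j \<omega> \<le> Umax" "C j \<omega> = j" if "j \<le> m" for j
        using X[of "Input_Size j"] X[of "Channel j"] that by (simp_all add: J_def A_def)
      ultimately have "Off \<omega> = {..m}"
        by (auto simp: offloading_def contending_def less_Suc_eq_le)
      then show "\<omega> \<in> {\<omega> \<in> space P. m < num_offloading K U C Umax \<omega>}"
        using \<omega> by (auto simp: num_offloading_def J_def)
    qed
  qed measurable
  finally show ?thesis .
qed

section \<open>Truncated exponential law\<close>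

text \<open>The unnormalised mean, that is, the integral of \<open>u\<close> over
  \<open>{..Umax}\<close> under the exponential law; the conditional mean is
  \<open>trunc_mean / prob_cont\<close>.\<close>

definition "trunc_mean = (1 - exp (- mu * Umax) * (1 + mu * Umax)) / mu"

text \<open>Positivity is \<open>1 + x < exp x\<close> at \<open>x = mu * Umax\<close>. The upper
  bound drops a nonnegative term and later yields \<open>mu \<le> mu_max\<close>.\<close>

lemma trunc_mean_bounds: "0 < trunc_mean" "trunc_mean \<le> prob_cont / mu"
proof -
  have "1 + mu * Umax < exp (mu * Umax)"
    using exp_less_mono[OF ln_add_one_self_less_self[of "mu * Umax"]] mu_pos Umax_pos
    by (simp add: add_pos_pos)
  then have "exp (- (mu * Umax)) * (1 + mu * Umax) < exp (- (mu * Umax)) * exp (mu * Umax)"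
    by (intro mult_strict_left_mono) auto
  then show "0 < trunc_mean"
    using mu_pos by (simp add: trunc_mean_def flip: exp_add)
  show "trunc_mean \<le> prob_cont / mu"
    using mu_pos Umax_pos
    by (auto simp: trunc_mean_def prob_cont_def algebra_simps intro!: divide_right_mono)
qed

lemma emeasure_input_law: "emeasure input_law {..Umax} = ennreal prob_cont"
proof -
  have "emeasure input_law {..Umax} = emeasure (distr P lborel (U 0)) {..Umax}"
    using U_distr[of 0] by (simp add: distributed_def)
  also have "\<dots> = ennreal (prob {\<omega> \<in> space P. U 0 \<omega> \<le> Umax})"
    by (subst emeasure_distr) (auto simp: emeasure_eq_measure intro!: arg_cong[where f = prob])
  finally show ?thesis by (simp add: prob_contending)
qed

lemma nn_integral_input_law:
  "(\<integral>\<^sup>+u. ennreal u * indicator {..Umax} u \<partial>input_law) = ennreal trunc_mean"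
proof -
  \<comment> \<open>The antiderivative of \<open>mu * u * exp (- u * mu)\<close>, found by parts.
    The density vanishes below 0, so the integral starts there.\<close>
  let ?F = "\<lambda>u. - exp (- u * mu) * (u + 1 / mu)"
  have "(\<integral>\<^sup>+u. ennreal u * indicator {..Umax} u \<partial>input_law) =
      (\<integral>\<^sup>+u. ennreal (mu * u * exp (- u * mu)) * indicator {0..Umax} u \<partial>lborel)"
    using mu_pos
    by (subst nn_integral_density)
      (auto simp: exponential_density_def indicator_def mult_ac ennreal_neg simp flip: ennreal_mult
        intro!: nn_integral_cong)
  also have "\<dots> = ?F Umax - ?F 0"
  proof (rule nn_integral_FTC_Icc)
    fix u assume "u \<in> {0..Umax}"
    show "(?F has_real_derivative mu * u * exp (- u * mu)) (at u)"
      using mu_pos by (auto intro!: derivative_eq_intros simp: field_simps)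
  qed (use mu_pos Umax_pos in auto)
  also have "?F Umax - ?F 0 = trunc_mean"
    using mu_pos by (simp add: trunc_mean_def field_simps)
  finally show ?thesis .
qed

section \<open>Almost sure signs and integrals under the SNR law\<close>

text \<open>The quantifier over \<open>k\<close> stands inside \<open>AE\<close> so that the bound
  also applies to a random device number.\<close>

lemma AE_U_nonneg: "AE \<omega> in P. \<forall>k. 0 \<le> U k \<omega>"
  unfolding AE_all_countable
proof
  fix k
  show "AE \<omega> in P. 0 \<le> U k \<omega>"
    by (subst distributed_AE2[OF U_distr]) (auto simp: exponential_density_def)
qed

lemma AE_SNR_pos: "AE \<omega> in P. \<forall>k. 0 < \<gamma> k \<omega>"
  unfolding AE_all_countable using SNR_pos by auto

lemma AE_snr_law_pos: "AE s in snr_law. 0 < s"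
  using SNR_pos[of 0] by (simp add: AE_distr_iff)

lemma nn_integral_snr_law:
  assumes "b \<in> borel_measurable borel" "\<And>s. s > 0 \<Longrightarrow> 0 \<le> b s" "integrable snr_law b"
  shows "(\<integral>\<^sup>+s. ennreal (b s) \<partial>snr_law) = ennreal (integral\<^sup>L snr_law b)"
proof (rule nn_integral_eq_integral)
  show "AE s in snr_law. 0 \<le> b s" using AE_snr_law_pos by eventually_elim (use assms in auto)
qed fact

lemma snr_law_integral_nonneg:
  fixes b :: "real \<Rightarrow> real"
  assumes "\<And>s. s > 0 \<Longrightarrow> 0 \<le> b s"
  shows "0 \<le> integral\<^sup>L snr_law b"
proof (rule integral_nonneg_AE)
  show "AE s in snr_law. 0 \<le> b s" using AE_snr_law_pos by eventually_elim (use assms in auto)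
qed

section \<open>Conditional means and the mean total upload time\<close>

text \<open>The conditional law given \<open>m < S\<close> is a product, with
  \<open>\<alpha> / prob_cont\<close> the mean of \<open>a\<close> under the truncated exponential
  law. Instances with \<open>a\<close> constant 1 or the identity yield every conditional
  expectation in the theorem.\<close>

lemma has_bochner_integral_offloading_device:
  fixes a b :: "real \<Rightarrow> real"
  assumes [measurable]: "a \<in> borel_measurable borel" "b \<in> borel_measurable borel"
    and a: "\<And>u. 0 \<le> u \<Longrightarrow> 0 \<le> a u" "0 \<le> \<alpha>"
      "(\<integral>\<^sup>+u. ennreal (a u) * indicator {..Umax} u \<partial>input_law) = ennreal \<alpha>"
    and b: "\<And>s. s > 0 \<Longrightarrow> 0 \<le> b s" "integrable snr_law b"
    and m: "m < M"
  shows "has_bochner_integral (uniform_measure P {\<omega> \<in> space P. m < num_offloading K U C Umax \<omega>})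
    (\<lambda>\<omega>. a (offl_size K U C Umax m \<omega>) * b (offl_snr K U \<gamma> C Umax m \<omega>))
    (\<alpha> / prob_cont * integral\<^sup>L snr_law b)"
proof (rule has_bochner_integral_nn_integral)
  let ?A = "{\<omega> \<in> space P. m < num_offloading K U C Umax \<omega>}"
  let ?\<beta> = "integral\<^sup>L snr_law b"
  have nonneg: "0 \<le> ?\<beta>" by (rule snr_law_integral_nonneg) (rule b)
  have [measurable]: "?A \<in> sets P" by measurable
  have pos: "0 < prob ?A" using prob_num_offloading_pos[OF m] .
  show "AE \<omega> in uniform_measure P ?A. 0 \<le> a (offl_size K U C Umax m \<omega>) * b (offl_snr K U \<gamma> C Umax m \<omega>)"
  proof (rule AE_uniform_measureI)
    show "AE \<omega> in P. \<omega> \<in> ?A \<longrightarrow> 0 \<le> a (offl_size K U C Umax m \<omega>) * b (offl_snr K U \<gamma> C Umax m \<omega>)"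
      using AE_U_nonneg AE_SNR_pos by eventually_elim (simp add: offl_size_def offl_snr_def a b)
  qed simp
  show "0 \<le> \<alpha> / prob_cont * ?\<beta>" using nonneg a prob_cont_bounds by simp
  \<comment> \<open>\<open>ennreal\<close> is multiplicative on nonnegative factors, and these signs
    hold only almost surely.\<close>
  have prod: "AE \<omega> in P. ennreal (a (offl_size K U C Umax m \<omega>) * b (offl_snr K U \<gamma> C Umax m \<omega>)) =
      ennreal (a (offl_size K U C Umax m \<omega>)) * ennreal (b (offl_snr K U \<gamma> C Umax m \<omega>))"
    using AE_U_nonneg AE_SNR_pos
    by eventually_elim (auto simp: offl_size_def offl_snr_def a b ennreal_mult)
  have "ennreal prob_cont * (\<integral>\<^sup>+\<omega>. ennreal (a (offl_size K U C Umax m \<omega>) * b (offl_snr K U \<gamma> C Umax m \<omega>)) *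
      indicator ?A \<omega> \<partial>P) =
    ennreal prob_cont * (\<integral>\<^sup>+\<omega>. ennreal (a (offl_size K U C Umax m \<omega>)) * ennreal (b (offl_snr K U \<gamma> C Umax m \<omega>)) *
      indicator {\<omega>. m < num_offloading K U C Umax \<omega>} \<omega> \<partial>P)"
  proof (intro arg_cong[where f = "(*) _"] nn_integral_cong_AE)
    show "AE \<omega> in P. ennreal (a (offl_size K U C Umax m \<omega>) * b (offl_snr K U \<gamma> C Umax m \<omega>)) *
        indicator ?A \<omega> = ennreal (a (offl_size K U C Umax m \<omega>)) * ennreal (b (offl_snr K U \<gamma> C Umax m \<omega>)) *
        indicator {\<omega>. m < num_offloading K U C Umax \<omega>} \<omega>"
      using prod AE_space by eventually_elim (simp add: indicator_def)
  qed
  also have "\<dots> = ennreal \<alpha> * ennreal ?\<beta> *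
      (\<integral>\<^sup>+\<omega>. indicator {\<omega>. m < num_offloading K U C Umax \<omega>} \<omega> \<partial>P)"
    using nn_integral_offloading_device[of "\<lambda>u. ennreal (a u)" "\<lambda>s. ennreal (b s)" m]
    by (simp add: emeasure_input_law a nn_integral_snr_law b)
  also have "(\<integral>\<^sup>+\<omega>. indicator {\<omega>. m < num_offloading K U C Umax \<omega>} \<omega> \<partial>P) = (\<integral>\<^sup>+\<omega>. indicator ?A \<omega> \<partial>P)"
    by (intro nn_integral_cong) (auto simp: indicator_def)
  also have "\<dots> = ennreal (prob ?A)" by (simp add: emeasure_eq_measure)
  finally have "(\<integral>\<^sup>+\<omega>. ennreal (a (offl_size K U C Umax m \<omega>) * b (offl_snr K U \<gamma> C Umax m \<omega>)) *
      indicator ?A \<omega> \<partial>P) = ennreal (\<alpha> * ?\<beta> * prob ?A / prob_cont)"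
    using prob_cont_bounds a nonneg by (intro ennreal_cancel_eq) (auto simp: ennreal_mult)
  then show "(\<integral>\<^sup>+\<omega>. ennreal (a (offl_size K U C Umax m \<omega>) * b (offl_snr K U \<gamma> C Umax m \<omega>))
      \<partial>uniform_measure P ?A) = ennreal (\<alpha> / prob_cont * ?\<beta>)"
    using pos prob_cont_bounds a nonneg
    by (subst nn_integral_uniform_measure) (auto simp: emeasure_eq_measure divide_ennreal)
qed simp

text \<open>The numbering of the offloading devices only reorders a finite sum; without it,
  \<open>nn_integral_sum_Off\<close> applies.\<close>

lemma total_upload_time_eq:
  "total_upload_time K U \<gamma> C Umax Bo \<omega> = (\<Sum>k\<in>Off \<omega>. U k \<omega> / (Bo * log 2 (1 + \<gamma> k \<omega>)))"
proof -
  let ?f = "\<lambda>k. U k \<omega> / (Bo * log 2 (1 + \<gamma> k \<omega>))"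
  have "(\<Sum>k\<in>Off \<omega>. ?f k) = (\<Sum>k\<leftarrow>sorted_list_of_set (Off \<omega>). ?f k)"
    by (subst sum_list_distinct_conv_sum_set) auto
  also have "\<dots> = (\<Sum>m<num_offloading K U C Umax \<omega>. ?f (sorted_list_of_set (Off \<omega>) ! m))"
    by (simp add: sum_list_sum_nth num_offloading_def atLeast0LessThan)
  finally show ?thesis
    by (simp add: total_upload_time_def upload_time_def offl_size_def offl_snr_def offloading_device_def)
qed

lemma has_bochner_integral_num_offloading:
  "has_bochner_integral P (\<lambda>\<omega>. real (num_offloading K U C Umax \<omega>))
    (lam * prob_cont * exp (- lam * prob_cont / real M))"
  using lam_pos prob_cont_bounds nn_integral_num_offloading
  by (intro has_bochner_integral_nn_integral) (auto simp: ennreal_of_nat_eq_real_of_nat)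

text \<open>Wald's identity with \<open>a\<close> the embedding into \<open>ennreal\<close> and
  \<open>b\<close> the upload time per unit of input. The first two factors of the value are the
  mean upload time of one device, the last is the mean of \<open>S\<close>.\<close>

lemma has_bochner_integral_total_upload_time:
  assumes int: "integrable snr_law (\<lambda>s. 1 / (Bo * log 2 (1 + s)))"
  shows "has_bochner_integral P (total_upload_time K U \<gamma> C Umax Bo)
    (trunc_mean / prob_cont * integral\<^sup>L snr_law (\<lambda>s. 1 / (Bo * log 2 (1 + s))) *
      (lam * prob_cont * exp (- lam * prob_cont / real M)))"
proof (rule has_bochner_integral_nn_integral)
  let ?b = "\<lambda>s. 1 / (Bo * log 2 (1 + s))"
  let ?\<beta> = "integral\<^sup>L snr_law ?b"
  let ?ES = "lam * prob_cont * exp (- lam * prob_cont / real M)"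
  have b: "0 \<le> ?b s" if "s > 0" for s using that Bo_pos by simp
  have nonneg: "0 \<le> ?\<beta>" by (rule snr_law_integral_nonneg) (rule b)
  have ES: "0 \<le> ?ES" using lam_pos prob_cont_bounds by simp
  show "AE \<omega> in P. 0 \<le> total_upload_time K U \<gamma> C Umax Bo \<omega>"
    using AE_U_nonneg AE_SNR_pos
  proof eventually_elim
    case (elim \<omega>)
    have "0 \<le> U k \<omega> * ?b (\<gamma> k \<omega>)" for k
      by (intro mult_nonneg_nonneg b) (use elim in auto)
    then show ?case by (simp add: total_upload_time_eq sum_nonneg)
  qed
  show "0 \<le> trunc_mean / prob_cont * ?\<beta> * ?ES"
    by (intro mult_nonneg_nonneg[OF mult_nonneg_nonneg] divide_nonneg_nonneg nonneg ES)
      (use trunc_mean_bounds prob_cont_bounds in auto)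
  have "AE \<omega> in P. ennreal (total_upload_time K U \<gamma> C Umax Bo \<omega>) =
      (\<Sum>k\<in>Off \<omega>. ennreal (U k \<omega>) * ennreal (?b (\<gamma> k \<omega>)))"
    using AE_U_nonneg AE_SNR_pos
  proof eventually_elim
    case (elim \<omega>)
    have "ennreal (U k \<omega>) * ennreal (?b (\<gamma> k \<omega>)) = ennreal (U k \<omega> / (Bo * log 2 (1 + \<gamma> k \<omega>)))" for k
      using elim b[of "\<gamma> k \<omega>"] by (subst ennreal_mult[symmetric]) auto
    moreover have "0 \<le> U k \<omega> * ?b (\<gamma> k \<omega>)" for k
      by (intro mult_nonneg_nonneg b) (use elim in auto)
    ultimately show ?case
      unfolding total_upload_time_eq by (simp add: sum_ennreal)
  qed
  then have "ennreal prob_cont * (\<integral>\<^sup>+\<omega>. ennreal (total_upload_time K U \<gamma> C Umax Bo \<omega>) \<partial>P) =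
      ennreal prob_cont * (\<integral>\<^sup>+\<omega>. (\<Sum>k\<in>Off \<omega>. ennreal (U k \<omega>) * ennreal (?b (\<gamma> k \<omega>))) \<partial>P)"
    by (intro arg_cong[where f = "(*) _"] nn_integral_cong_AE)
  also have "\<dots> = ennreal trunc_mean * ennreal ?\<beta> * ennreal ?ES"
    using nn_integral_sum_Off[of ennreal "\<lambda>s. ennreal (?b s)"] nn_integral_snr_law[OF _ b int]
    by (simp add: emeasure_input_law nn_integral_input_law nn_integral_num_offloading)
  finally have "(\<integral>\<^sup>+\<omega>. ennreal (total_upload_time K U \<gamma> C Umax Bo \<omega>) \<partial>P) =
      ennreal (trunc_mean * ?\<beta> * ?ES / prob_cont)"
    using prob_cont_bounds trunc_mean_bounds nonneg ES
    by (intro ennreal_cancel_eq) (auto simp: ennreal_mult simp del: times_divide_eq_right)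
  then show "(\<integral>\<^sup>+\<omega>. ennreal (total_upload_time K U \<gamma> C Umax Bo \<omega>) \<partial>P) =
      ennreal (trunc_mean / prob_cont * ?\<beta> * ?ES)"
    by (simp add: mult_ac)
qed simp

text \<open>Conditioning on \<open>{..Umax}\<close> divides the unnormalised mean by the mass
  \<open>prob_cont\<close>; the rate is the reciprocal of the result.\<close>

lemma trunc_exp_rate_eq: "trunc_exp_rate mu Umax = prob_cont / trunc_mean"
proof -
  have "has_bochner_integral (uniform_measure input_law {..Umax}) (\<lambda>u. u) (trunc_mean / prob_cont)"
  proof (rule has_bochner_integral_nn_integral)
    have "AE u in input_law. 0 \<le> u"
      by (subst AE_density) (auto simp: exponential_density_def)
    then show "AE u in uniform_measure input_law {..Umax}. 0 \<le> u"
      by (intro AE_uniform_measureI) (auto elim: eventually_mono)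
    show "(\<integral>\<^sup>+u. ennreal u \<partial>uniform_measure input_law {..Umax}) = ennreal (trunc_mean / prob_cont)"
      using trunc_mean_bounds prob_cont_bounds
      by (subst nn_integral_uniform_measure)
        (auto simp: nn_integral_input_law emeasure_input_law divide_ennreal)
  qed (use trunc_mean_bounds prob_cont_bounds in auto)
  then show ?thesis
    by (simp add: trunc_exp_rate_def cond_expectation_def has_bochner_integral_integral_eq)
qed

section \<open>Expectations of the inverse SNR and inverse spectral efficiency\<close>

lemma integrable_inverse_snr: "integrable snr_law (\<lambda>s. 1 / s)"
  using SNR_inverse_integrable[of 0] by (simp add: integrable_distr_eq)

text \<open>Dominated by the bound of \<open>one_div_log_le\<close>, which is integrable because
  \<open>1 / s\<close> is.\<close>

lemma integrable_inverse_log_snr: "integrable snr_law (\<lambda>s. 1 / log 2 (1 + s))"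
proof (rule Bochner_Integration.integrable_bound)
  interpret G: prob_space snr_law by (rule prob_space_distr) simp
  show "integrable snr_law (\<lambda>s. ln 2 * (1 / 2 + 1 / s))"
    using integrable_inverse_snr by (intro integrable_mult_right Bochner_Integration.integrable_add) auto
  show "AE s in snr_law. norm (1 / log 2 (1 + s)) \<le> norm (ln 2 * (1 / 2 + 1 / s))"
    using AE_snr_law_pos by eventually_elim (use one_div_log_le in force)
qed simp

lemma integral_inverse_log_snr_le:
  "integral\<^sup>L snr_law (\<lambda>s. 1 / log 2 (1 + s)) \<le> ln 2 * (1 / 2 + integral\<^sup>L snr_law (\<lambda>s. 1 / s))"
proof -
  interpret G: prob_space snr_law by (rule prob_space_distr) simp
  have "integral\<^sup>L snr_law (\<lambda>s. 1 / log 2 (1 + s)) \<le> integral\<^sup>L snr_law (\<lambda>s. ln 2 * (1 / 2 + 1 / s))"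
  proof (rule integral_mono_AE)
    show "AE s in snr_law. 1 / log 2 (1 + s) \<le> ln 2 * (1 / 2 + 1 / s)"
      using AE_snr_law_pos by eventually_elim (rule one_div_log_le)
  qed (use integrable_inverse_snr integrable_inverse_log_snr in auto)
  also have "\<dots> = ln 2 * (1 / 2 + integral\<^sup>L snr_law (\<lambda>s. 1 / s))"
    using integrable_inverse_snr G.prob_space by simp
  finally show ?thesis .
qed

text \<open>Used to see that conditioning on \<open>U' \<le> Umax\<close> within the event
  \<open>m < S\<close> leaves that event unchanged.\<close>

lemma offl_size_le:
  assumes "m < num_offloading K U C Umax \<omega>"
  shows "offl_size K U C Umax m \<omega> \<le> Umax"
proof -
  have "offloading_device K U C Umax m \<omega> \<in> Off \<omega>"
    using assms nth_mem[of m "sorted_list_of_set (Off \<omega>)"]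
    by (simp add: offloading_device_def num_offloading_def)
  then show ?thesis by (simp add: offl_size_def offloading_def contending_def)
qed

end

theorem lemma1:
  fixes P :: "'a measure"
    and K :: "'a \<Rightarrow> nat"
    and U \<gamma> :: "nat \<Rightarrow> 'a \<Rightarrow> real"
    and C :: "nat \<Rightarrow> 'a \<Rightarrow> nat"
    and lam mu Umax Bo qo mu_max :: real
    and M k m :: nat
    and S :: "'a \<Rightarrow> nat"
    and D :: "'a \<Rightarrow> real"
    and U' \<gamma>' T' :: "'a \<Rightarrow> real"
    and A :: "'a set"
  assumes model: "offloading_model P K U \<gamma> C lam mu Umax M Bo"
    and qo: "qo = measure P {\<omega> \<in> space P. U k \<omega> \<le> Umax}"
    and mu_max: "mu_max = trunc_exp_rate mu Umax"
    and S: "S = num_offloading K U C Umax"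
    and D: "D = total_upload_time K U \<gamma> C Umax Bo"
    and m: "m < M"
    and A: "A = {\<omega> \<in> space P. m < S \<omega>}"
    and U': "U' = offl_size K U C Umax m"
    and \<gamma>': "\<gamma>' = offl_snr K U \<gamma> C Umax m"
    and T': "T' = upload_time K U \<gamma> C Umax Bo m"
  shows "measure P A > 0
    \<and> qo = 1 - exp (- mu * Umax)
    \<and> mu_max = 1 / cond_expectation P U' {\<omega> \<in> A. U' \<omega> \<le> Umax}
    \<and> mu_max = mu * (1 - exp (- mu * Umax)) / (1 - exp (- mu * Umax) * (1 + mu * Umax))
    \<and> integrable P D
    \<and> integrable P (\<lambda>\<omega>. real (S \<omega>))
    \<and> integrable (uniform_measure P A) T'
    \<and> integrable (uniform_measure P A) (\<lambda>\<omega>. 1 / log 2 (1 + \<gamma>' \<omega>))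
    \<and> integrable (uniform_measure P A) (\<lambda>\<omega>. 1 / \<gamma>' \<omega>)
    \<and> integral\<^sup>L P D = integral\<^sup>L P (\<lambda>\<omega>. real (S \<omega>)) * cond_expectation P T' A
    \<and> integral\<^sup>L P (\<lambda>\<omega>. real (S \<omega>)) = lam * qo * exp (- lam * qo / real M)
    \<and> integral\<^sup>L P D = lam * qo * exp (- lam * qo / real M) * (1 / (Bo * mu_max))
         * cond_expectation P (\<lambda>\<omega>. 1 / log 2 (1 + \<gamma>' \<omega>)) A
    \<and> lam * qo * exp (- lam * qo / real M) * (1 / (Bo * mu_max))
         * cond_expectation P (\<lambda>\<omega>. 1 / log 2 (1 + \<gamma>' \<omega>)) A
       \<le> lam * qo * exp (- lam * qo / real M) * (ln 2 / (Bo * mu_max))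
         * (1 / 2 + cond_expectation P (\<lambda>\<omega>. 1 / \<gamma>' \<omega>) A)
    \<and> lam * qo * exp (- lam * qo / real M) * (ln 2 / (Bo * mu_max))
         * (1 / 2 + cond_expectation P (\<lambda>\<omega>. 1 / \<gamma>' \<omega>) A)
       \<le> lam * qo * exp (- lam * qo / real M) * (ln 2 / (Bo * mu))
         * (1 / 2 + cond_expectation P (\<lambda>\<omega>. 1 / \<gamma>' \<omega>) A)"
proof -
  interpret offloading_model P K U \<gamma> C lam mu Umax M Bo by (rule model)
  let ?b = "integral\<^sup>L snr_law (\<lambda>s. 1 / log 2 (1 + s))"
  let ?g = "integral\<^sup>L snr_law (\<lambda>s. 1 / s)"
  let ?ES = "lam * qo * exp (- lam * qo / real M)"
  have qo': "qo = prob_cont" using prob_contending by (simp add: qo)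
  have pos: "0 < qo" "0 < trunc_mean" using prob_cont_bounds trunc_mean_bounds by (auto simp: qo')
  have mu_max': "mu_max = qo / trunc_mean" by (simp add: mu_max trunc_exp_rate_eq qo')
  have A_pos: "measure P A > 0" using prob_num_offloading_pos[OF m] by (simp add: A S)
  have A_restrict: "{\<omega> \<in> A. U' \<omega> \<le> Umax} = A"
    using offl_size_le by (auto simp: A U' S)
  \<comment> \<open>For \<open>a\<close> constant 1 the value of \<open>\<alpha>\<close> is
    \<open>prob_cont\<close>, so the size factor becomes \<open>qo / qo\<close>.\<close>
  have one: "(\<integral>\<^sup>+u. ennreal 1 * indicator {..Umax} u \<partial>input_law) = ennreal prob_cont"
    by (simp add: emeasure_input_law)
  interpret G: prob_space snr_law by (rule prob_space_distr) simp
  have G_1: "G.prob UNIV = 1" using G.prob_space by simp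
  have Bo_log: "1 / (Bo * log 2 (1 + s)) = 1 / Bo * (1 / log 2 (1 + s))" for s by simp
  have int_Bo: "integrable snr_law (\<lambda>s. 1 / (Bo * log 2 (1 + s)))"
    unfolding Bo_log by (intro integrable_mult_right integrable_inverse_log_snr)
  have integral_Bo: "integral\<^sup>L snr_law (\<lambda>s. 1 / (Bo * log 2 (1 + s))) = 1 / Bo * ?b"
    unfolding Bo_log by (rule integral_mult_right_zero)
  have "has_bochner_integral (uniform_measure P A) (\<lambda>\<omega>. U' \<omega> * 1) (trunc_mean / qo * integral\<^sup>L snr_law (\<lambda>_. 1))"
    unfolding A S U' qo'
    by (rule has_bochner_integral_offloading_device[where b = "\<lambda>_. 1"])
      (use m pos nn_integral_input_law in auto)
  then have size: "cond_expectation P U' A = trunc_mean / qo"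
    by (simp add: cond_expectation_def has_bochner_integral_integral_eq G_1)
  have "has_bochner_integral (uniform_measure P A) (\<lambda>\<omega>. 1 * (1 / log 2 (1 + \<gamma>' \<omega>))) (qo / qo * ?b)"
    unfolding A S \<gamma>' qo'
    by (rule has_bochner_integral_offloading_device[where a = "\<lambda>_. 1" and b = "\<lambda>s. 1 / log 2 (1 + s)"])
      (use m pos one prob_cont_bounds integrable_inverse_log_snr in auto)
  then have log: "has_bochner_integral (uniform_measure P A) (\<lambda>\<omega>. 1 / log 2 (1 + \<gamma>' \<omega>)) ?b"
    using pos by simp
  have "has_bochner_integral (uniform_measure P A) (\<lambda>\<omega>. 1 * (1 / \<gamma>' \<omega>)) (qo / qo * ?g)"
    unfolding A S \<gamma>' qo'
    by (rule has_bochner_integral_offloading_device[where a = "\<lambda>_. 1" and b = "\<lambda>s. 1 / s"])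
      (use m pos one prob_cont_bounds integrable_inverse_snr in auto)
  then have inv: "has_bochner_integral (uniform_measure P A) (\<lambda>\<omega>. 1 / \<gamma>' \<omega>) ?g"
    using pos by simp
  have "has_bochner_integral (uniform_measure P A) (\<lambda>\<omega>. U' \<omega> * (1 / (Bo * log 2 (1 + \<gamma>' \<omega>))))
      (trunc_mean / qo * integral\<^sup>L snr_law (\<lambda>s. 1 / (Bo * log 2 (1 + s))))"
    unfolding A S U' \<gamma>' qo'
    by (rule has_bochner_integral_offloading_device[where b = "\<lambda>s. 1 / (Bo * log 2 (1 + s))"])
      (use m pos nn_integral_input_law Bo_pos int_Bo in auto)
  then have time: "has_bochner_integral (uniform_measure P A) T' (trunc_mean / qo * (1 / Bo * ?b))"
    unfolding integral_Bo by (simp add: T' U' \<gamma>' upload_time_def[abs_def])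
  have number: "has_bochner_integral P (\<lambda>\<omega>. real (S \<omega>)) ?ES"
    unfolding S qo' by (rule has_bochner_integral_num_offloading)
  have total: "has_bochner_integral P D (trunc_mean / qo * (1 / Bo * ?b) * ?ES)"
    using has_bochner_integral_total_upload_time[OF int_Bo] unfolding D qo' integral_Bo .
  have g: "0 \<le> ?g" by (rule snr_law_integral_nonneg) simp
  have ES: "0 < ?ES" using pos lam_pos by simp
  have "?ES * (1 / (Bo * mu_max)) * ?b \<le> ?ES * (1 / (Bo * mu_max)) * (ln 2 * (1 / 2 + ?g))"
    by (intro mult_left_mono integral_inverse_log_snr_le mult_nonneg_nonneg[OF less_imp_le[OF ES]])
      (use pos Bo_pos in \<open>auto simp: mu_max'\<close>)
  then have bound1: "?ES * (1 / (Bo * mu_max)) * ?b \<le> ?ES * (ln 2 / (Bo * mu_max)) * (1 / 2 + ?g)"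
    by simp
  \<comment> \<open>Truncation lowers the mean size, so the rate rises; this gives the last
    inequality of the theorem.\<close>
  have "mu \<le> mu_max"
    using trunc_mean_bounds pos mu_pos by (simp add: mu_max' qo' field_simps)
  then have bound2: "?ES * (ln 2 / (Bo * mu_max)) * (1 / 2 + ?g) \<le> ?ES * (ln 2 / (Bo * mu)) * (1 / 2 + ?g)"
    using ES g mu_pos Bo_pos
    by (intro mult_right_mono mult_left_mono divide_left_mono) (auto intro: mult_pos_pos)
  have rate: "mu_max = 1 / (trunc_mean / qo)"
    "mu_max = mu * (1 - exp (- mu * Umax)) / (1 - exp (- mu * Umax) * (1 + mu * Umax))"
    using mu_pos by (simp_all add: mu_max' qo' prob_cont_def trunc_mean_def mult.commute)
  \<comment> \<open>One value, two readings: the mean of \<open>S\<close> times the mean of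
    \<open>T'\<close>, and the displayed formula with \<open>1 / (Bo * mu_max)\<close>.\<close>
  have prod: "trunc_mean / qo * (1 / Bo * ?b) * ?ES = ?ES * (trunc_mean / qo * (1 / Bo * ?b))"
    "trunc_mean / qo * (1 / Bo * ?b) * ?ES = ?ES * (1 / (Bo * mu_max)) * ?b"
    by (simp_all add: mu_max')
  \<comment> \<open>Once each expectation is replaced by its closed form, every conjunct is one of
    the facts collected above.\<close>
  show ?thesis
    unfolding A_restrict size
    unfolding cond_expectation_def
      has_bochner_integral_integral_eq[OF log] has_bochner_integral_integral_eq[OF inv]
      has_bochner_integral_integral_eq[OF time] has_bochner_integral_integral_eq[OF number]
      has_bochner_integral_integral_eq[OF total]
    by (intro conjI A_pos rate qo'[unfolded prob_cont_def] prod bound1 bound2 refl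
        log[THEN integrable.intros] inv[THEN integrable.intros]
        time[THEN integrable.intros] number[THEN integrable.intros] total[THEN integrable.intros])
qed

end
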